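(* If a simply connected space $X$ is pre-c-symplectic, then the Hasse diagram $\mathcal{H}(X)$ of rational toral ranks of $X$ contains the point $P=(r_0(X)-1,\,1)$.
   Context: For a space $Y$ with finite-dimensional rational cohomology, the formal dimension is $fd(Y)=\max\{i : H^i(Y;\mathbb{Q})\neq 0\}$. $Y$ is a rationally Poincaré dual space if $H^*(Y;\mathbb{Q})$ is a Poincaré duality algebra. A rationally Poincaré dual space $Y$ with $fd(Y)=2m$ is c-symplectic (cohomologically symplectic) if there is $\omega\in H^2(Y;\mathbb{Q})$ such that $\omega^m\ne 0$ in $H^{2m}(Y;\mathbb{Q})$. A simply connected space $X$ is pre-c-symplectic if it is the fibre of a (rational) fibration $X\to Y\to \mathbb{C}P^\infty$ where $Y$ is c-symplectic. This depends only on the rational homotopy type of $X$: if $(\Lambda V,d)$, with $V=\bigoplus_{i\ge 2}V^i$ and $\dim V^i<\infty$, is the Sullivan minimal model of $X$, it means that there is a relative Sullivan model $(\mathbb{Q}[t],0)\to(\mathbb{Q}[t]\otimes\Lambda V,D)\to(\Lambda V,d)$ with $|t|=2$, $Dt=0$, $Dv\equiv dv$ modulo the ideal $(t)$ for $v\in V$, such that $(\mathbb{Q}[t]\otimes\Lambda V,D)$ is the model of a c-symplectic space. For a simply connected space $X$ with $\dim H^*(X;\mathbb{Q})<\infty$, the rational toral rank $r_0(X)$ is the largest integer $r$ such that an $r$-torus $T^r=S^1\times\cdots\times S^1$ can act continuously on a finite complex $X'$ in the rational homotopy type of $X$ with all isotropy subgroups finite. Equivalently (Halperin), $r_0(X)\ge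 r$ iff there is a relative model $(\mathbb{Q}[t_1,\dots,t_r],0)\to(\mathbb{Q}[t_1,\dots,t_r]\otimes\Lambda V,D)\to(\Lambda V,d)$ with $|t_i|=2$, $Dt_i=0$, $Dv\equiv dv$ modulo $(t_1,\dots,t_r)$ and $\dim H^*(\mathbb{Q}[t_1,\dots,t_r]\otimes\Lambda V,D)<\infty$; in that case $T^r$ acts freely on some finite complex $X'$ of the rational homotopy type of $X$ with $(\mathbb{Q}[t_1,\dots,t_r]\otimes\Lambda V,D)$ a model of $ET^r\times_{T^r}X'$. The Hasse diagram $\mathcal{H}(X)$ of rational toral ranks: whenever $T^t$ acts freely on a finite complex $X'$ of the same rational homotopy type as $X$, the Borel space $Y=ET^t\times_{T^t}X'$ presents the lattice point $P=[Y]=(s,t)$, where $s,t\ge 0$, $s+t\le r_0(X)$ and $s$ is determined by $r_0(ET^t\times_{T^t}X')=r_0(X)-s-t$; the point $(0,0)$ is presented by $X$ itself. The points of $\mathcal{H}(X)$ are all points so presented. They are ordered by $P_i<P_j$ when there are presentations $P_i=[Y_1]=(s_1,t_1)$, $P_j=[Y_2]=(s_2,t_2)$ with $s_1\le s_2$, $t_1<t_2$ and a rational fibration $Y_1\to Y_2\to BT^{t_2-t_1}$; $\mathcal{H}(X)$ is the Hasse diagram of this poset. *)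

theory Defs
  imports "HOL-Homology.Homology" "HOL-Library.Function_Algebras" "HOL-Library.Multiset"
begin

section \<open>Rational algebras\<close>

class rat_algebra_1 = ring_1 +
  fixes scaleQ :: "rat \<Rightarrow> 'a \<Rightarrow> 'a"  (infixr \<open>*\<^sub>Q\<close> 75)
  assumes scaleQ_add_right: "c *\<^sub>Q (x + y) = c *\<^sub>Q x + c *\<^sub>Q y"
    and scaleQ_add_left: "(b + c) *\<^sub>Q x = b *\<^sub>Q x + c *\<^sub>Q x"
    and scaleQ_scaleQ: "b *\<^sub>Q c *\<^sub>Q x = (b * c) *\<^sub>Q x"
    and scaleQ_one: "1 *\<^sub>Q x = x"
    and mult_scaleQ_left: "(c *\<^sub>Q x) * y = c *\<^sub>Q (x * y)"
    and mult_scaleQ_right: "x * (c *\<^sub>Q y) = c *\<^sub>Q (x * y)"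

global_interpretation rat_vector: vector_space "scaleQ :: rat \<Rightarrow> 'a \<Rightarrow> 'a::rat_algebra_1"
  by unfold_locales
    (simp_all add: scaleQ_add_right scaleQ_add_left scaleQ_scaleQ scaleQ_one)

instantiation "fun" :: (type, rat_algebra_1) rat_algebra_1
begin

definition scaleQ_fun :: "rat \<Rightarrow> ('a \<Rightarrow> 'b) \<Rightarrow> 'a \<Rightarrow> 'b" where
  "scaleQ_fun c f = (\<lambda>x. c *\<^sub>Q f x)"

instance
  by standard
    (simp_all add: scaleQ_fun_def fun_eq_iff scaleQ_add_right scaleQ_add_left scaleQ_scaleQ
      scaleQ_one mult_scaleQ_left mult_scaleQ_right)

end


section \<open>The free graded commutative algebra on generators in all degrees\<close>

text \<open>
  \<open>Gen n i\<close> is the \<open>i\<close>-th generator of degree \<open>n\<close>. All free graded commutative algebras needed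
  below are subalgebras of the one on the whole type \<open>gen\<close>. A graded vector space
  of finite type is then given by its dimensions in each degree.
\<close>

datatype gen = Gen (gdeg: nat) (gidx: nat)

instantiation gen :: linorder
begin

definition less_eq_gen :: "gen \<Rightarrow> gen \<Rightarrow> bool" where
  "g \<le> h \<longleftrightarrow> gdeg g < gdeg h \<or> gdeg g = gdeg h \<and> gidx g \<le> gidx h"

definition less_gen :: "gen \<Rightarrow> gen \<Rightarrow> bool" where
  "g < h \<longleftrightarrow> gdeg g < gdeg h \<or> gdeg g = gdeg h \<and> gidx g < gidx h"

instance
  by standard (auto simp: less_eq_gen_def less_gen_def gen.expand)

end

text \<open>
  A multiset in which every generator of odd degree occurs at most once stands for the product
  of its elements in increasing order; these products form a basis.
\<close>

definition admissible :: "gen multiset \<Rightarrow> bool" where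
  "admissible m \<longleftrightarrow> (\<forall>g. odd (gdeg g) \<longrightarrow> count m g \<le> 1)"

definition monomial_degree :: "gen multiset \<Rightarrow> nat" where
  "monomial_degree m = (\<Sum>g\<in>#m. gdeg g)"

typedef cga = "{p :: gen multiset \<Rightarrow>\<^sub>0 rat. \<forall>m\<in>Poly_Mapping.keys p. admissible m}"
  by (rule exI[of _ 0]) simp

definition coefficient :: "cga \<Rightarrow> gen multiset \<Rightarrow> rat" where
  "coefficient x = Poly_Mapping.lookup (Rep_cga x)"

definition monomials :: "cga \<Rightarrow> gen multiset set" where
  "monomials x = Poly_Mapping.keys (Rep_cga x)"

lemma cga_eqI: "(\<And>m. coefficient x m = coefficient y m) \<Longrightarrow> x = y"
  unfolding coefficient_def by (metis Rep_cga_inject poly_mapping_eqI)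

lemma finite_monomials [simp]: "finite (monomials x)"
  by (simp add: monomials_def)

lemma in_monomials_iff: "m \<in> monomials x \<longleftrightarrow> coefficient x m \<noteq> 0"
  by (simp add: monomials_def coefficient_def in_keys_iff)

lemma coefficient_not_admissible: "\<not> admissible m \<Longrightarrow> coefficient x m = 0"
  using Rep_cga[of x] by (auto simp: coefficient_def in_keys_iff)

lemma coefficient_Abs:
  "(\<And>m. \<not> admissible m \<Longrightarrow> Poly_Mapping.lookup p m = 0) \<Longrightarrow>
    coefficient (Abs_cga p) = Poly_Mapping.lookup p"
  unfolding coefficient_def by (subst Abs_cga_inverse) (auto simp: in_keys_iff)

instantiation cga :: ab_group_add
begin

definition "0 = Abs_cga 0"
definition "x + y = Abs_cga (Rep_cga x + Rep_cga y)"
definition "- x = Abs_cga (- Rep_cga x)"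
definition "x - y = Abs_cga (Rep_cga x - Rep_cga y)"

lemma coefficient_zero [simp]: "coefficient 0 m = 0"
  by (simp add: zero_cga_def coefficient_Abs)

lemma coefficient_add [simp]: "coefficient (x + y) m = coefficient x m + coefficient y m"
  unfolding plus_cga_def
  by (subst coefficient_Abs)
    (simp_all add: lookup_add coefficient_def flip: coefficient_def,
     simp_all add: coefficient_not_admissible coefficient_def[symmetric])

lemma coefficient_uminus [simp]: "coefficient (- x) m = - coefficient x m"
  unfolding uminus_cga_def
  by (subst coefficient_Abs)
    (simp_all add: coefficient_not_admissible coefficient_def[symmetric])

lemma coefficient_diff [simp]: "coefficient (x - y) m = coefficient x m - coefficient y m"
  unfolding minus_cga_def
  by (subst coefficient_Abs)
    (simp_all add: lookup_minus coefficient_not_admissible coefficient_def[symmetric])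

instance
  by standard (rule cga_eqI; simp)+

end

definition rat_scale :: "rat \<Rightarrow> cga \<Rightarrow> cga" where
  "rat_scale c x = Abs_cga (Poly_Mapping.map ((*) c) (Rep_cga x))"

lemma coefficient_rat_scale [simp]: "coefficient (rat_scale c x) m = c * coefficient x m"
  unfolding rat_scale_def
  by (subst coefficient_Abs)
    (auto simp: Poly_Mapping.map.rep_eq when_def coefficient_not_admissible coefficient_def[symmetric])

text \<open>\<open>monomial m\<close> is zero if \<open>m\<close> contains the square of a generator of odd degree.\<close>

definition monomial :: "gen multiset \<Rightarrow> cga" where
  "monomial m = (if admissible m then Abs_cga (Poly_Mapping.single m 1) else 0)"

lemma coefficient_monomial:
  "coefficient (monomial m) n = (if m = n \<and> admissible m then 1 else 0)"
proof (cases "admissible m")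
  case True
  then have "coefficient (Abs_cga (Poly_Mapping.single m 1)) = Poly_Mapping.lookup (Poly_Mapping.single m 1)"
    by (intro coefficient_Abs) (auto simp: lookup_single when_def)
  with True show ?thesis
    by (simp add: monomial_def lookup_single when_def)
qed (simp add: monomial_def)

definition linear_extension :: "(gen multiset \<Rightarrow> cga) \<Rightarrow> cga \<Rightarrow> cga" where
  "linear_extension F x = (\<Sum>m\<in>monomials x. rat_scale (coefficient x m) (F m))"

text \<open>The sign from sorting the product of two increasing products of generators.\<close>

definition koszul_sign :: "gen multiset \<Rightarrow> gen multiset \<Rightarrow> rat" where
  "koszul_sign m n =
    (- 1) ^ (\<Sum>g\<in>#m. \<Sum>h\<in>#n. if odd (gdeg g) \<and> odd (gdeg h) \<and> h < g then 1 else 0 :: nat)"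

lemma koszul_sign_add_left: "koszul_sign (m + n) p = koszul_sign m p * koszul_sign n p"
  by (simp add: koszul_sign_def power_add)

lemma koszul_sign_add_right: "koszul_sign m (n + p) = koszul_sign m n * koszul_sign m p"
  by (simp add: koszul_sign_def power_add sum_mset.distrib)

lemma koszul_sign_empty [simp]: "koszul_sign {#} m = 1" "koszul_sign m {#} = 1"
  by (simp_all add: koszul_sign_def)

lemma coefficient_sum: "coefficient (sum f A) m = (\<Sum>a\<in>A. coefficient (f a) m)"
  by (induction A rule: infinite_finite_induct) auto

lemma rat_scale_simps:
  "rat_scale c (x + y) = rat_scale c x + rat_scale c y"
  "rat_scale (b + c) x = rat_scale b x + rat_scale c x"
  "rat_scale b (rat_scale c x) = rat_scale (b * c) x"
  "rat_scale 1 x = x" "rat_scale 0 x = 0" "rat_scale c 0 = 0"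
  by (rule cga_eqI; simp add: algebra_simps)+

lemma rat_scale_sum: "rat_scale c (sum f A) = (\<Sum>a\<in>A. rat_scale c (f a))"
  by (induction A rule: infinite_finite_induct) (auto simp: rat_scale_simps)

lemma linear_extension_superset:
  assumes "finite S" "monomials x \<subseteq> S"
  shows "linear_extension F x = (\<Sum>m\<in>S. rat_scale (coefficient x m) (F m))"
  unfolding linear_extension_def using assms
  by (intro sum.mono_neutral_left) (auto simp: in_monomials_iff rat_scale_simps)

lemma linear_extension_add:
  "linear_extension F (x + y) = linear_extension F x + linear_extension F y"
proof -
  let ?S = "monomials x \<union> monomials y \<union> monomials (x + y)"
  have eq: "linear_extension F z = (\<Sum>m\<in>?S. rat_scale (coefficient z m) (F m))"
    if "z = x \<or> z = y \<or> z = x + y" for z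
    using that by (intro linear_extension_superset) auto
  show ?thesis
    unfolding eq[of x, simplified] eq[of y, simplified] eq[of "x + y", simplified]
    by (simp add: rat_scale_simps sum.distrib)
qed

lemma linear_extension_scale:
  "linear_extension F (rat_scale c x) = rat_scale c (linear_extension F x)"
proof -
  have "monomials (rat_scale c x) \<subseteq> monomials x"
    by (auto simp: in_monomials_iff)
  then have "linear_extension F (rat_scale c x)
      = (\<Sum>m\<in>monomials x. rat_scale (coefficient (rat_scale c x) m) (F m))"
    by (intro linear_extension_superset) auto
  then show ?thesis
    by (simp add: linear_extension_def rat_scale_simps rat_scale_sum)
qed

lemma linear_extension_zero: "linear_extension F 0 = 0"
  by (simp add: linear_extension_def monomials_def zero_cga_def Abs_cga_inverse)

lemma linear_extension_sum:
  "linear_extension F (sum f A) = (\<Sum>a\<in>A. linear_extension F (f a))"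
  by (induction A rule: infinite_finite_induct)
    (auto simp: linear_extension_add linear_extension_zero)

lemma linear_extension_monomial:
  "linear_extension F (monomial m) = (if admissible m then F m else 0)"
proof (cases "admissible m")
  case True
  have "monomials (monomial m) \<subseteq> {m}"
    by (auto simp: in_monomials_iff coefficient_monomial split: if_splits)
  from linear_extension_superset[OF _ this, of F] True show ?thesis
    by (simp add: coefficient_monomial rat_scale_simps)
qed (simp add: monomial_def linear_extension_zero)

lemma linear_extension_monomial_id: "linear_extension monomial x = x"
proof (rule cga_eqI)
  fix n
  have "coefficient (linear_extension monomial x) n
      = (\<Sum>m\<in>monomials x. if n = m then coefficient x m else 0)"
    unfolding linear_extension_def coefficient_sum coefficient_rat_scale coefficient_monomial
    by (rule sum.cong) (auto simp: in_monomials_iff coefficient_not_admissible)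
  then show "coefficient (linear_extension monomial x) n = coefficient x n"
    by (auto simp: in_monomials_iff)
qed

lemma linear_extension_fun_add:
  "linear_extension (\<lambda>m. F m + G m) x = linear_extension F x + linear_extension G x"
  by (simp add: linear_extension_def rat_scale_simps sum.distrib)

lemma linear_extension_fun_scale:
  "linear_extension (\<lambda>m. rat_scale c (F m)) x = rat_scale c (linear_extension F x)"
  by (simp add: linear_extension_def rat_scale_simps rat_scale_sum mult.commute)

lemma linear_extension_compose:
  "linear_extension F (linear_extension G x) = linear_extension (\<lambda>m. linear_extension F (G m)) x"
  by (simp add: linear_extension_def[of G] linear_extension_sum linear_extension_scale
      linear_extension_def[of _ x])

lemma admissible_addD: "admissible (m + n) \<Longrightarrow> admissible m \<and> admissible n"
  unfolding admissible_def by (metis add_leE count_union)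

instantiation cga :: rat_algebra_1
begin

definition "(1 :: cga) = monomial {#}"

definition times_cga :: "cga \<Rightarrow> cga \<Rightarrow> cga" where
  "x * y = linear_extension
    (\<lambda>m. linear_extension (\<lambda>n. rat_scale (koszul_sign m n) (monomial (m + n))) y) x"

definition scaleQ_cga :: "rat \<Rightarrow> cga \<Rightarrow> cga" where "scaleQ_cga = rat_scale"

lemma monomial_mult: "monomial m * monomial n = rat_scale (koszul_sign m n) (monomial (m + n))"
proof (cases "admissible m \<and> admissible n")
  case False
  then have "\<not> admissible (m + n)" using admissible_addD by blast
  then show ?thesis using False
    by (auto simp: times_cga_def linear_extension_monomial monomial_def linear_extension_zero
        linear_extension_def rat_scale_simps)
qed (simp add: times_cga_def linear_extension_monomial)

lemma cga_mult_add_left: "(x + y) * z = x * z + y * (z :: cga)"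
  by (simp add: times_cga_def linear_extension_add)

lemma cga_mult_add_right: "z * (x + y) = z * x + z * (y :: cga)"
  by (simp add: times_cga_def linear_extension_add linear_extension_fun_add)

lemma cga_mult_scale_left: "rat_scale c x * y = rat_scale c (x * y)"
  by (simp add: times_cga_def linear_extension_scale)

lemma cga_mult_scale_right: "x * rat_scale c y = rat_scale c (x * y)"
  by (simp add: times_cga_def linear_extension_scale linear_extension_fun_scale)

lemma cga_induct:
  assumes "P 0" "\<And>x y. P x \<Longrightarrow> P y \<Longrightarrow> P (x + y)" "\<And>c x. P x \<Longrightarrow> P (rat_scale c x)"
    "\<And>m. P (monomial m)"
  shows "P x"
proof -
  have "P (\<Sum>m\<in>A. rat_scale (coefficient x m) (monomial m))" for A
    by (induction A rule: infinite_finite_induct) (auto intro: assms)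
  then show ?thesis
    using linear_extension_monomial_id[of x] by (metis linear_extension_def)
qed

instance
proof
  have zero: "0 * x = 0" "x * 0 = 0" for x :: cga
    using cga_mult_scale_left[of 0 0 x] cga_mult_scale_right[of x 0 0]
    by (simp_all add: rat_scale_simps)
  have mono: "monomial m * monomial n * monomial p = monomial m * (monomial n * monomial p)"
    for m n p
    by (simp add: monomial_mult cga_mult_scale_left cga_mult_scale_right rat_scale_simps
        koszul_sign_add_left koszul_sign_add_right add.assoc mult_ac)
  have "monomial m * monomial n * c = monomial m * (monomial n * c)" for m n c
    by (induction c rule: cga_induct)
      (simp_all add: mono zero cga_mult_add_right cga_mult_scale_right)
  then have "monomial m * b * c = monomial m * (b * c)" for m b c
    by (induction b rule: cga_induct)
      (simp_all add: zero cga_mult_add_left cga_mult_add_right cga_mult_scale_left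
        cga_mult_scale_right)
  then show "a * b * c = a * (b * c)" for a b c :: cga
    by (induction a rule: cga_induct)
      (simp_all add: zero cga_mult_add_left cga_mult_scale_left)
  show "1 * a = a" for a :: cga
    by (induction a rule: cga_induct)
      (simp_all add: zero cga_mult_add_right cga_mult_scale_right monomial_mult one_cga_def
        rat_scale_simps)
  show "a * 1 = a" for a :: cga
    by (induction a rule: cga_induct)
      (simp_all add: zero cga_mult_add_left cga_mult_scale_left monomial_mult one_cga_def
        rat_scale_simps)
  have "coefficient 1 {#} = 1"
    by (simp add: one_cga_def coefficient_monomial admissible_def)
  then show "(0 :: cga) \<noteq> 1"
    by (metis coefficient_zero zero_neq_one)
qed (simp_all add: scaleQ_cga_def rat_scale_simps cga_mult_add_left cga_mult_add_right
    cga_mult_scale_left cga_mult_scale_right)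

end

definition gen_elt :: "gen \<Rightarrow> cga" where
  "gen_elt g = monomial {#g#}"

text \<open>\<open>\<Lambda>V\<close>, for \<open>V\<close> with basis \<open>G\<close>, and its component of degree \<open>n\<close>.\<close>

definition free_cga :: "gen set \<Rightarrow> cga set" where
  "free_cga G = {x. \<forall>m\<in>monomials x. set_mset m \<subseteq> G}"

definition free_cga_deg :: "gen set \<Rightarrow> nat \<Rightarrow> cga set" where
  "free_cga_deg G n = {x \<in> free_cga G. \<forall>m\<in>monomials x. monomial_degree m = n}"

text \<open>The homomorphism of algebras given by (degree preserving) values on the generators.\<close>

definition algebra_extension :: "(gen \<Rightarrow> cga) \<Rightarrow> cga \<Rightarrow> cga" where
  "algebra_extension f = linear_extension (\<lambda>m. prod_list (map f (sorted_list_of_multiset m)))"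

text \<open>The derivation of degree one given by its values on the generators.\<close>

fun derivation_word :: "(gen \<Rightarrow> cga) \<Rightarrow> gen list \<Rightarrow> cga" where
  "derivation_word f [] = 0"
| "derivation_word f (g # gs) =
    f g * prod_list (map gen_elt gs) + (- 1) ^ gdeg g * gen_elt g * derivation_word f gs"

definition derivation_extension :: "(gen \<Rightarrow> cga) \<Rightarrow> cga \<Rightarrow> cga" where
  "derivation_extension f =
    linear_extension (\<lambda>m. derivation_word f (sorted_list_of_multiset m))"


section \<open>Cohomology of differential graded algebras\<close>

text \<open>
  A differential graded algebra is given by its graded components \<open>A n\<close> and its differential \<open>d\<close>.
  A cohomology class is represented by a cocycle, up to coboundaries.
\<close>

definition cocycles :: "(nat \<Rightarrow> 'a::rat_algebra_1 set) \<Rightarrow> ('a \<Rightarrow> 'a) \<Rightarrow> nat \<Rightarrow> 'a set" where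
  "cocycles A d n = {x \<in> A n. d x = 0}"

definition coboundaries :: "(nat \<Rightarrow> 'a::rat_algebra_1 set) \<Rightarrow> ('a \<Rightarrow> 'a) \<Rightarrow> nat \<Rightarrow> 'a set" where
  "coboundaries A d n = insert 0 {d y | y m. y \<in> A m \<and> n = Suc m}"

definition cohomology_nonzero ::
    "(nat \<Rightarrow> 'a::rat_algebra_1 set) \<Rightarrow> ('a \<Rightarrow> 'a) \<Rightarrow> nat \<Rightarrow> bool" where
  "cohomology_nonzero A d n \<longleftrightarrow> \<not> cocycles A d n \<subseteq> coboundaries A d n"

definition finite_dim_cohomology ::
    "(nat \<Rightarrow> 'a::rat_algebra_1 set) \<Rightarrow> ('a \<Rightarrow> 'a) \<Rightarrow> bool" where
  "finite_dim_cohomology A d \<longleftrightarrow>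
    (\<exists>B. finite B \<and> B \<subseteq> (\<Union>n. cocycles A d n) \<and>
      (\<Union>n. cocycles A d n) \<subseteq> rat_vector.span (B \<union> (\<Union>n. coboundaries A d n)))"

definition formal_dimension :: "(nat \<Rightarrow> 'a::rat_algebra_1 set) \<Rightarrow> ('a \<Rightarrow> 'a) \<Rightarrow> nat" where
  "formal_dimension A d = (GREATEST n. cohomology_nonzero A d n)"

text \<open>One-dimensional top cohomology, and a nondegenerate multiplication into it.\<close>

definition poincare_duality :: "(nat \<Rightarrow> 'a::rat_algebra_1 set) \<Rightarrow> ('a \<Rightarrow> 'a) \<Rightarrow> bool" where
  "poincare_duality A d \<longleftrightarrow>
    finite_dim_cohomology A d \<and>
    (let n = formal_dimension A d in
      (\<exists>z \<in> cocycles A d n - coboundaries A d n.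
        \<forall>x \<in> cocycles A d n. \<exists>c. x - c *\<^sub>Q z \<in> coboundaries A d n) \<and>
      (\<forall>i\<le>n. \<forall>x \<in> cocycles A d i - coboundaries A d i.
        \<exists>y \<in> cocycles A d (n - i). x * y \<notin> coboundaries A d n))"

definition c_symplectic :: "(nat \<Rightarrow> 'a::rat_algebra_1 set) \<Rightarrow> ('a \<Rightarrow> 'a) \<Rightarrow> bool" where
  "c_symplectic A d \<longleftrightarrow>
    poincare_duality A d \<and>
    (\<exists>m. formal_dimension A d = 2 * m \<and>
      (\<exists>\<omega> \<in> cocycles A d 2. \<omega> ^ m \<notin> coboundaries A d (2 * m)))"

text \<open>
  Multiplicative maps inducing a bijection in cohomology. Preservation of the unit is not included,
  as the unit of \<open>A\<close> need not be the element \<open>1\<close> of the ambient type.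
\<close>

definition quasi_isomorphism ::
    "(nat \<Rightarrow> 'a::rat_algebra_1 set) \<Rightarrow> ('a \<Rightarrow> 'a) \<Rightarrow>
     (nat \<Rightarrow> 'b::rat_algebra_1 set) \<Rightarrow> ('b \<Rightarrow> 'b) \<Rightarrow> ('a \<Rightarrow> 'b) \<Rightarrow> bool" where
  "quasi_isomorphism A d A' d' \<phi> \<longleftrightarrow>
    (\<forall>n. \<forall>x \<in> A n. \<phi> x \<in> A' n \<and> \<phi> (d x) = d' (\<phi> x)) \<and>
    (\<forall>n. \<forall>x \<in> A n. \<forall>y \<in> A n. \<phi> (x + y) = \<phi> x + \<phi> y) \<and>
    (\<forall>n c. \<forall>x \<in> A n. \<phi> (c *\<^sub>Q x) = c *\<^sub>Q \<phi> x) \<and>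
    (\<forall>m n. \<forall>x \<in> A m. \<forall>y \<in> A n. \<phi> (x * y) = \<phi> x * \<phi> y) \<and>
    (\<forall>n. \<forall>x \<in> cocycles A d n. \<phi> x \<in> coboundaries A' d' n \<longrightarrow> x \<in> coboundaries A d n) \<and>
    (\<forall>n. \<forall>z \<in> cocycles A' d' n. \<exists>x \<in> cocycles A d n. z - \<phi> x \<in> coboundaries A' d' n)"


section \<open>Sullivan's polynomial forms on a space\<close>

text \<open>
  Polynomial forms on the \<open>p\<close>-simplex: the barycentric coordinates satisfy \<open>t\<^sub>0 + \<dots> + t\<^sub>p = 1\<close>,
  so the algebra is free on \<open>t\<^sub>1, \<dots>, t\<^sub>p\<close> and \<open>dt\<^sub>1, \<dots>, dt\<^sub>p\<close>, where \<open>t\<^sub>i\<close> is \<open>Gen 0 i\<close> and \<open>dt\<^sub>i\<close>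
  is \<open>Gen 1 i\<close>.
\<close>

definition simplex_forms :: "nat \<Rightarrow> nat \<Rightarrow> cga set" where
  "simplex_forms p = free_cga_deg {Gen n i | n i. n \<le> 1 \<and> 1 \<le> i \<and> i \<le> p}"

definition barycentric :: "nat \<Rightarrow> nat \<Rightarrow> cga" where
  "barycentric p i = (if i = 0 then 1 - (\<Sum>j=1..p. gen_elt (Gen 0 j)) else gen_elt (Gen 0 i))"

definition d_barycentric :: "nat \<Rightarrow> nat \<Rightarrow> cga" where
  "d_barycentric p i = (if i = 0 then - (\<Sum>j=1..p. gen_elt (Gen 1 j)) else gen_elt (Gen 1 i))"

definition de_rham :: "cga \<Rightarrow> cga" where
  "de_rham = derivation_extension (\<lambda>g. if gdeg g = 0 then gen_elt (Gen 1 (gidx g)) else 0)"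

text \<open>
  The affine map from the \<open>p\<close>-simplex induced by the map of vertices \<open>\<theta>\<close> sends \<open>x\<close> to the point with
  coordinates \<open>\<Sum>i\<in>\<theta>\<^sup>-\<^sup>1(j). x i\<close>; the next two definitions are composition of a simplex with
  it, and pullback of forms along it.
\<close>

definition simplex_pullback ::
    "nat \<Rightarrow> (nat \<Rightarrow> nat) \<Rightarrow> ((nat \<Rightarrow> real) \<Rightarrow> 'a) \<Rightarrow> (nat \<Rightarrow> real) \<Rightarrow> 'a" where
  "simplex_pullback p \<theta> \<sigma> =
    restrict (\<lambda>x. \<sigma> (\<lambda>j. \<Sum>i | i \<le> p \<and> \<theta> i = j. x i)) (standard_simplex p)"

definition form_pullback :: "nat \<Rightarrow> (nat \<Rightarrow> nat) \<Rightarrow> cga \<Rightarrow> cga" where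
  "form_pullback p \<theta> = algebra_extension
    (\<lambda>g. \<Sum>i | i \<le> p \<and> \<theta> i = gidx g. if gdeg g = 0 then barycentric p i else d_barycentric p i)"

text \<open>
  Families of forms, one on each singular simplex, compatible with all simplicial operators; the
  value \<open>0\<close> at functions that are not singular simplices makes the representation unique.
\<close>

definition A_PL :: "'a topology \<Rightarrow> nat \<Rightarrow> (nat \<Rightarrow> ((nat \<Rightarrow> real) \<Rightarrow> 'a) \<Rightarrow> cga) set" where
  "A_PL X n = {\<eta>.
    (\<forall>p \<sigma>. if singular_simplex p X \<sigma> then \<eta> p \<sigma> \<in> simplex_forms p n else \<eta> p \<sigma> = 0) \<and>
    (\<forall>p q \<theta> \<sigma>. mono_on {..p} \<theta> \<and> \<theta> ` {..p} \<subseteq> {..q} \<and> singular_simplex q X \<sigma> \<longrightarrow>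
      \<eta> p (simplex_pullback p \<theta> \<sigma>) = form_pullback p \<theta> (\<eta> q \<sigma>))}"

definition d_PL ::
    "(nat \<Rightarrow> ((nat \<Rightarrow> real) \<Rightarrow> 'a) \<Rightarrow> cga) \<Rightarrow> nat \<Rightarrow> ((nat \<Rightarrow> real) \<Rightarrow> 'a) \<Rightarrow> cga" where
  "d_PL \<eta> = (\<lambda>p \<sigma>. de_rham (\<eta> p \<sigma>))"


section \<open>Sullivan models\<close>

text \<open>The basis of a graded vector space \<open>V\<close> with \<open>dim V\<^sup>n = k n\<close>.\<close>

definition gens :: "(nat \<Rightarrow> nat) \<Rightarrow> gen set" where
  "gens k = {Gen n i | n i. i < k n}"

abbreviation Lambda :: "(nat \<Rightarrow> nat) \<Rightarrow> nat \<Rightarrow> cga set" where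
  "Lambda k \<equiv> free_cga_deg (gens k)"

text \<open>
  If \<open>V\<close> is concentrated in degrees at least two, the nilpotence condition on Sullivan algebras
  and on relative Sullivan algebras holds for degree reasons.
\<close>

definition sullivan_algebra :: "(nat \<Rightarrow> nat) \<Rightarrow> (cga \<Rightarrow> cga) \<Rightarrow> bool" where
  "sullivan_algebra k d \<longleftrightarrow>
    k 0 = 0 \<and> k 1 = 0 \<and>
    (\<forall>n. \<forall>x \<in> Lambda k n. d x \<in> Lambda k (Suc n) \<and> d (d x) = 0) \<and>
    (\<forall>n. \<forall>x \<in> Lambda k n. \<forall>y \<in> Lambda k n. d (x + y) = d x + d y) \<and>
    (\<forall>n c. \<forall>x \<in> Lambda k n. d (c *\<^sub>Q x) = c *\<^sub>Q d x) \<and>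
    (\<forall>m n. \<forall>x \<in> Lambda k m. \<forall>y \<in> Lambda k n. d (x * y) = d x * y + (- 1) ^ m * x * d y)"

definition minimal_sullivan_algebra :: "(nat \<Rightarrow> nat) \<Rightarrow> (cga \<Rightarrow> cga) \<Rightarrow> bool" where
  "minimal_sullivan_algebra k d \<longleftrightarrow>
    sullivan_algebra k d \<and> (\<forall>g \<in> gens k. \<forall>m \<in> monomials (d (gen_elt g)). 2 \<le> size m)"

definition minimal_model_of :: "'a topology \<Rightarrow> (nat \<Rightarrow> nat) \<Rightarrow> (cga \<Rightarrow> cga) \<Rightarrow> bool" where
  "minimal_model_of X k d \<longleftrightarrow>
    minimal_sullivan_algebra k d \<and>
    (\<exists>\<phi>. quasi_isomorphism (Lambda k) d (A_PL X) d_PL \<phi> \<and>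
      (\<forall>p \<sigma>. singular_simplex p X \<sigma> \<longrightarrow> \<phi> 1 p \<sigma> = 1))"

text \<open>
  For \<open>V\<close> with dimensions \<open>k\<close>, the algebra \<open>\<rat>[t\<^sub>0, \<dots>, t\<^bsub>r-1\<^esub>] \<otimes> \<Lambda>V\<close> is the free algebra with
  dimensions \<open>adjoin r k\<close>; it contains \<open>\<Lambda>V\<close>, and \<open>poly_gen k j\<close> is \<open>t\<^sub>j\<close>.
\<close>

definition adjoin :: "nat \<Rightarrow> (nat \<Rightarrow> nat) \<Rightarrow> nat \<Rightarrow> nat" where
  "adjoin r k = k(2 := k 2 + r)"

definition poly_gen :: "(nat \<Rightarrow> nat) \<Rightarrow> nat \<Rightarrow> gen" where
  "poly_gen k j = Gen 2 (k 2 + j)"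

definition poly_ideal :: "nat \<Rightarrow> (nat \<Rightarrow> nat) \<Rightarrow> cga set" where
  "poly_ideal r k =
    {\<Sum>j<r. gen_elt (poly_gen k j) * a j | a. \<forall>j<r. a j \<in> free_cga (gens (adjoin r k))}"

definition relative_model ::
    "nat \<Rightarrow> (nat \<Rightarrow> nat) \<Rightarrow> (cga \<Rightarrow> cga) \<Rightarrow> (cga \<Rightarrow> cga) \<Rightarrow> bool" where
  "relative_model r k d D \<longleftrightarrow>
    sullivan_algebra (adjoin r k) D \<and>
    (\<forall>j<r. D (gen_elt (poly_gen k j)) = 0) \<and>
    (\<forall>g \<in> gens k. D (gen_elt g) - d (gen_elt g) \<in> poly_ideal r k)"


section \<open>Pre-c-symplectic spaces and rational toral ranks\<close>

definition simply_connected_space :: "'a topology \<Rightarrow> bool" where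
  "simply_connected_space X \<longleftrightarrow>
    path_connected_space X \<and>
    (\<forall>f. continuous_map (top_of_set (sphere (0::complex) 1)) X f \<longrightarrow>
      (\<exists>c. homotopic_with (\<lambda>_. True) (top_of_set (sphere 0 1)) X f (\<lambda>_. c)))"

definition pre_c_symplectic :: "'a topology \<Rightarrow> bool" where
  "pre_c_symplectic X \<longleftrightarrow>
    (\<exists>k d D. minimal_model_of X k d \<and> relative_model 1 k d D \<and>
      c_symplectic (Lambda (adjoin 1 k)) D)"

text \<open>
  By Halperin's theorem, these are the models of the Borel spaces of free actions of the
  \<open>r\<close>-torus on finite complexes in the rational homotopy type modelled by \<open>k, d\<close>.
\<close>

definition borel_model ::
    "nat \<Rightarrow> (nat \<Rightarrow> nat) \<Rightarrow> (cga \<Rightarrow> cga) \<Rightarrow> (cga \<Rightarrow> cga) \<Rightarrow> bool" where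
  "borel_model r k d D \<longleftrightarrow>
    relative_model r k d D \<and> finite_dim_cohomology (Lambda (adjoin r k)) D"

text \<open>The rational toral rank of the rational homotopy type modelled by \<open>k, d\<close>.\<close>

definition model_toral_rank :: "(nat \<Rightarrow> nat) \<Rightarrow> (cga \<Rightarrow> cga) \<Rightarrow> nat" where
  "model_toral_rank k d = (GREATEST r. \<exists>D. borel_model r k d D)"

definition toral_rank :: "'a topology \<Rightarrow> nat" where
  "toral_rank X = (GREATEST r. \<exists>k d D. minimal_model_of X k d \<and> borel_model r k d D)"

text \<open>
  The points of the Hasse diagram of rational toral ranks of \<open>X\<close>. The Borel space is represented by
  its model \<open>D\<close>; for \<open>t = 0\<close> this is the minimal model of \<open>X\<close>.
\<close>

definition hasse_points :: "'a topology \<Rightarrow> (nat \<times> nat) set" where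
  "hasse_points X = {(s, t). s + t \<le> toral_rank X \<and>
    (\<exists>k d D. minimal_model_of X k d \<and> borel_model t k d D \<and>
      model_toral_rank (adjoin t k) D = toral_rank X - s - t)}"

end

theory Submission
  imports Defs
begin

text \<open>
  A c-symplectic space \<open>Y\<close> with \<open>X \<rightarrow> Y \<rightarrow> \<complex>P\<^sup>\<infinity>\<close> is itself the Borel space of a circle action on
  \<open>X\<close>, so it presents a point \<open>(s, 1)\<close>. That \<open>s = r\<^sub>0(X) - 1\<close> means that \<open>r\<^sub>0(Y) = 0\<close>, and the point
  lies in the diagram once \<open>r\<^sub>0(X) \<ge> 1\<close>.

  Both facts rest on the Gysin sequence. If \<open>\<rat>[t] \<otimes> \<Lambda>V\<close> is a relative model over \<open>\<Lambda>V\<close> whose cohomology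
  has top degree \<open>N\<close>, then the exact sequence
  \<open>H\<^sup>i(\<rat>[t] \<otimes> \<Lambda>V) \<rightarrow> H\<^sup>i(\<Lambda>V) \<rightarrow> H\<^bsup>i-1\<^esup>(\<rat>[t] \<otimes> \<Lambda>V) \<rightarrow> H\<^bsup>i+1\<^esup>(\<rat>[t] \<otimes> \<Lambda>V)\<close>,
  in which the last map is multiplication by \<open>t\<close>, shows that the cohomology of \<open>\<Lambda>V\<close> has top degree
  \<open>N + 1\<close>. Adjoining \<open>r\<close> polynomial generators one at a time gives \<open>N + r\<close>
  (\<open>torus_extension_top_degree\<close>).

  For \<open>X\<close> this yields \<open>r \<le> fd(X)\<close> for every torus of rank \<open>r\<close> acting almost freely. The maximum in the
  definition of \<open>r\<^sub>0(X)\<close> is therefore attained, and the circle action with Borel space \<open>Y\<close> makes it at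
  least \<open>1\<close> (\<open>toral_rank_ge\<close>).

  For \<open>Y\<close>, let \<open>\<omega>\<close> be a symplectic class, \<open>\<omega>\<^sup>m \<noteq> 0\<close> in the top degree \<open>2m\<close>, and suppose that an
  \<open>r\<close>-torus with \<open>r \<ge> 1\<close> acts almost freely on \<open>Y\<close>. The algebra is concentrated in degrees \<open>0\<close> and
  \<open>\<ge> 2\<close>, and the polynomial generators have degree two, so they cannot occur in the differential of
  \<open>\<omega>\<close>, which has degree three: \<open>\<omega>\<close> remains a cocycle in the Borel model. There
  \<open>\<omega>\<^sup>m\<close> lies in degree \<open>2m\<close>, above the top degree \<open>2m - r\<close>, and is thus a coboundary. Restricting to
  the fibre makes \<open>\<omega>\<^sup>m\<close> a coboundary for \<open>Y\<close>, a contradiction (\<open>c_symplectic_borel_model\<close>).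
\<close>


section \<open>Restricting elements to a set of monomials\<close>

lemma coefficient_scaleQ [simp]: "coefficient (c *\<^sub>Q x) m = c * coefficient x m"
  by (simp add: scaleQ_cga_def)

definition restrict_monomials :: "gen multiset set \<Rightarrow> cga \<Rightarrow> cga" where
  "restrict_monomials S = linear_extension (\<lambda>m. if m \<in> S then monomial m else 0)"

lemma coefficient_restrict_monomials [simp]:
  "coefficient (restrict_monomials S x) n = (if n \<in> S then coefficient x n else 0)"
proof -
  have "coefficient (restrict_monomials S x) n
      = (\<Sum>m\<in>monomials x. if n = m then if n \<in> S then coefficient x m else 0 else 0)"
    unfolding restrict_monomials_def linear_extension_def coefficient_sum coefficient_rat_scale
    by (rule sum.cong) (auto simp: coefficient_monomial in_monomials_iff coefficient_not_admissible)
  then show ?thesis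
    by (auto simp: in_monomials_iff)
qed

abbreviation component :: "nat \<Rightarrow> cga \<Rightarrow> cga" where
  "component n \<equiv> restrict_monomials {m. monomial_degree m = n}"

text \<open>The map of algebras that fixes the generators in \<open>G\<close> and kills all others.\<close>

abbreviation retract :: "gen set \<Rightarrow> cga \<Rightarrow> cga" where
  "retract G \<equiv> restrict_monomials {m. set_mset m \<subseteq> G}"

lemma restrict_monomials_linear:
  "restrict_monomials S 0 = 0"
  "restrict_monomials S (x + y) = restrict_monomials S x + restrict_monomials S y"
  "restrict_monomials S (x - y) = restrict_monomials S x - restrict_monomials S y"
  "restrict_monomials S (- x) = - restrict_monomials S x"
  "restrict_monomials S (c *\<^sub>Q x) = c *\<^sub>Q restrict_monomials S x"
  by (rule cga_eqI; simp)+

lemma retract_monomial: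
  "retract G (monomial m) = (if set_mset m \<subseteq> G then monomial m else 0)"
  by (rule cga_eqI) (auto simp: coefficient_monomial)

lemma retract_gen_elt: "retract G (gen_elt g) = (if g \<in> G then gen_elt g else 0)"
  by (simp add: gen_elt_def retract_monomial)

lemma retract_one: "retract G 1 = 1"
  by (simp add: one_cga_def retract_monomial)

lemma retract_mult: "retract G (x * y) = retract G x * retract G y"
proof -
  have mono: "retract G (monomial m * monomial n) = retract G (monomial m) * retract G (monomial n)"
    for m n
    by (simp add: monomial_mult retract_monomial restrict_monomials_linear flip: scaleQ_cga_def)
  have "retract G (monomial m * y) = retract G (monomial m) * retract G y" for m
    by (induction y rule: cga_induct)
      (simp_all add: mono restrict_monomials_linear distrib_left mult_scaleQ_right
        flip: scaleQ_cga_def)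
  then show ?thesis
    by (induction x rule: cga_induct)
      (simp_all add: restrict_monomials_linear distrib_right mult_scaleQ_left
        flip: scaleQ_cga_def)
qed

lemma retract_sign: "retract G ((- 1) ^ n) = (- 1) ^ n"
  by (induction n) (simp_all add: retract_one retract_mult restrict_monomials_linear)


section \<open>The graded pieces of a free graded commutative algebra\<close>

lemma free_cga_deg_iff:
  "x \<in> free_cga_deg G n \<longleftrightarrow>
    (\<forall>m. coefficient x m \<noteq> 0 \<longrightarrow> set_mset m \<subseteq> G \<and> monomial_degree m = n)"
  by (auto simp: free_cga_deg_def free_cga_def in_monomials_iff)

lemma free_cga_deg_linear:
  "0 \<in> free_cga_deg G n"
  "x \<in> free_cga_deg G n \<Longrightarrow> y \<in> free_cga_deg G n \<Longrightarrow> x + y \<in> free_cga_deg G n"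
  "x \<in> free_cga_deg G n \<Longrightarrow> y \<in> free_cga_deg G n \<Longrightarrow> x - y \<in> free_cga_deg G n"
  "x \<in> free_cga_deg G n \<Longrightarrow> c *\<^sub>Q x \<in> free_cga_deg G n"
  unfolding free_cga_deg_iff
  by (simp_all, metis add_cancel_right_right, metis diff_0_right)

lemma monomial_in_free_cga_deg:
  "set_mset m \<subseteq> G \<Longrightarrow> monomial_degree m = n \<Longrightarrow> monomial m \<in> free_cga_deg G n"
  by (auto simp: free_cga_deg_iff coefficient_monomial split: if_splits)

lemma gen_elt_in_free_cga_deg: "g \<in> G \<Longrightarrow> gen_elt g \<in> free_cga_deg G (gdeg g)"
  unfolding gen_elt_def by (rule monomial_in_free_cga_deg) (auto simp: monomial_degree_def)

lemma one_in_free_cga_deg: "1 \<in> free_cga_deg G 0"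
  unfolding one_cga_def by (rule monomial_in_free_cga_deg) (auto simp: monomial_degree_def)

lemma free_cga_deg_induct [consumes 1, case_names zero add scale monomial]:
  assumes x: "x \<in> free_cga_deg G n"
    and zero: "P 0"
    and add: "\<And>x y. x \<in> free_cga_deg G n \<Longrightarrow> y \<in> free_cga_deg G n \<Longrightarrow> P x \<Longrightarrow> P y \<Longrightarrow> P (x + y)"
    and scale: "\<And>c x. x \<in> free_cga_deg G n \<Longrightarrow> P x \<Longrightarrow> P (c *\<^sub>Q x)"
    and monomial: "\<And>m. set_mset m \<subseteq> G \<Longrightarrow> monomial_degree m = n \<Longrightarrow> m \<in> monomials x \<Longrightarrow> P (monomial m)"
  shows "P x"
proof -
  have *: "(\<Sum>m\<in>A. coefficient x m *\<^sub>Q monomial m) \<in> free_cga_deg G n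
      \<and> P (\<Sum>m\<in>A. coefficient x m *\<^sub>Q monomial m)" if "finite A" "A \<subseteq> monomials x" for A
    using that
  proof (induction A)
    case (insert m A)
    then have m: "set_mset m \<subseteq> G" "monomial_degree m = n" "m \<in> monomials x"
      using x by (auto simp: free_cga_deg_iff in_monomials_iff)
    with insert show ?case
      by (auto intro!: add scale monomial free_cga_deg_linear monomial_in_free_cga_deg)
  qed (auto simp: zero free_cga_deg_linear)
  have "x = (\<Sum>m\<in>monomials x. coefficient x m *\<^sub>Q monomial m)"
    using linear_extension_monomial_id[of x] by (simp add: linear_extension_def scaleQ_cga_def)
  with *[of "monomials x"] show ?thesis
    by simp
qed

lemma free_cga_deg_mult:
  assumes "x \<in> free_cga_deg G m" and "y \<in> free_cga_deg G n"
  shows "x * y \<in> free_cga_deg G (m + n)"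
  using assms(1)
proof (induction x rule: free_cga_deg_induct)
  case (monomial p)
  show ?case
    using assms(2)
  proof (induction y rule: free_cga_deg_induct)
    case (monomial q)
    with \<open>set_mset p \<subseteq> G\<close> \<open>monomial_degree p = m\<close>
    have "monomial (p + q) \<in> free_cga_deg G (m + n)"
      by (intro monomial_in_free_cga_deg) (auto simp: monomial_degree_def)
    then show ?case
      by (simp add: monomial_mult free_cga_deg_linear flip: scaleQ_cga_def)
  qed (simp_all add: distrib_left mult_scaleQ_right free_cga_deg_linear)
qed (simp_all add: distrib_right mult_scaleQ_left free_cga_deg_linear)

lemma free_cga_deg_power:
  "x \<in> free_cga_deg G n \<Longrightarrow> x ^ i \<in> free_cga_deg G (n * i)"
  by (induction i) (auto simp: one_in_free_cga_deg intro: free_cga_deg_mult)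

lemma free_cga_deg_mono: "G \<subseteq> H \<Longrightarrow> x \<in> free_cga_deg G n \<Longrightarrow> x \<in> free_cga_deg H n"
  by (auto simp: free_cga_deg_iff)

lemma retract_in_free_cga_deg: "x \<in> free_cga_deg H n \<Longrightarrow> retract G x \<in> free_cga_deg G n"
  by (auto simp: free_cga_deg_iff split: if_splits)

lemma retract_id: "x \<in> free_cga_deg G n \<Longrightarrow> retract G x = x"
  by (rule cga_eqI) (auto simp: free_cga_deg_iff)

lemma retract_retract: "G \<subseteq> H \<Longrightarrow> retract G (retract H x) = retract G x"
  by (rule cga_eqI) auto

lemma component_free_cga_deg:
  "x \<in> free_cga_deg G i \<Longrightarrow> component n x = (if i = n then x else 0)"
  by (rule cga_eqI) (auto simp: free_cga_deg_iff)

text \<open>Up to sign, every monomial is built up by left multiplication with generators.\<close>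

lemma monomial_add_mset:
  "\<exists>c. monomial (add_mset g m) = c *\<^sub>Q (gen_elt g * monomial m)"
proof -
  have "koszul_sign {#g#} m * koszul_sign {#g#} m = 1"
    by (simp add: koszul_sign_def flip: power_mult_distrib)
  then have "monomial (add_mset g m) = koszul_sign {#g#} m *\<^sub>Q (gen_elt g * monomial m)"
    by (simp add: gen_elt_def monomial_mult scaleQ_cga_def rat_scale_simps)
  then show ?thesis
    by blast
qed


section \<open>Multiplication by a generator of even degree\<close>

lemma gen_elt_even_mult_monomial:
  "even (gdeg g) \<Longrightarrow> gen_elt g * monomial m = monomial (add_mset g m)"
  by (simp add: gen_elt_def monomial_mult koszul_sign_def rat_scale_simps)

lemma coefficient_gen_elt_even_mult:
  assumes "even (gdeg g)"
  shows "coefficient (gen_elt g * y) (add_mset g m) = coefficient y m"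
proof -
  have "admissible (add_mset g m) = admissible m" for m
    using assms by (auto simp: admissible_def)
  then show ?thesis
    by (induction y rule: cga_induct)
      (simp_all add: distrib_left mult_scaleQ_right gen_elt_even_mult_monomial assms
        coefficient_monomial flip: scaleQ_cga_def)
qed

lemma gen_elt_even_mult_cancel:
  assumes "even (gdeg g)" "gen_elt g * x = gen_elt g * y"
  shows "x = y"
  using assms by (metis cga_eqI coefficient_gen_elt_even_mult)

text \<open>
  The kernel of the map killing \<open>g\<close> is the principal ideal of \<open>g\<close>, since its elements are combinations
  of monomials that contain \<open>g\<close>. The case \<open>x = 0\<close> is separate because in degrees below that of \<open>g\<close>
  there is no degree for the quotient.
\<close>

lemma divisible_by_even_generator:
  assumes g: "even (gdeg g)" "g \<notin> G"
    and x: "x \<in> free_cga_deg (insert g G) n" "retract G x = 0"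
  shows "x = 0 \<or> (\<exists>i y. n = gdeg g + i \<and> y \<in> free_cga_deg (insert g G) i \<and> x = gen_elt g * y)"
  using x(1)
proof (induction x rule: free_cga_deg_induct)
  case (add x y)
  show ?case
  proof (cases "x = 0 \<or> y = 0")
    case False
    with add obtain i u j v where
      "n = gdeg g + i" "u \<in> free_cga_deg (insert g G) i" "x = gen_elt g * u"
      "n = gdeg g + j" "v \<in> free_cga_deg (insert g G) j" "y = gen_elt g * v"
      by blast
    then have "u + v \<in> free_cga_deg (insert g G) i" "n = gdeg g + i"
      "x + y = gen_elt g * (u + v)"
      by (simp_all add: free_cga_deg_linear distrib_left)
    then show ?thesis
      by blast
  qed (use add in auto)
next
  case (scale c x)
  then show ?case
    by (metis free_cga_deg_linear(4) mult_scaleQ_right rat_vector.scale_zero_right)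
next
  case (monomial m)
  have "coefficient (retract G x) m = 0"
    by (simp add: x(2))
  with monomial have "g \<in># m"
    by (auto simp: in_monomials_iff split: if_splits)
  then obtain p where p: "m = add_mset g p"
    by (metis multi_member_split)
  have "monomial p \<in> free_cga_deg (insert g G) (monomial_degree p)"
    using monomial p by (intro monomial_in_free_cga_deg) auto
  moreover have "n = gdeg g + monomial_degree p"
    using monomial p by (simp add: monomial_degree_def)
  ultimately show ?case
    using p gen_elt_even_mult_monomial[OF g(1)] by metis
qed simp


section \<open>Sullivan algebras and their cohomology\<close>

lemma sullivan_algebraD:
  assumes "sullivan_algebra k d"
  shows "k 0 = 0" "k 1 = 0"
    "x \<in> Lambda k n \<Longrightarrow> d x \<in> Lambda k (Suc n)"
    "x \<in> Lambda k n \<Longrightarrow> d (d x) = 0"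
    "x \<in> Lambda k n \<Longrightarrow> y \<in> Lambda k n \<Longrightarrow> d (x + y) = d x + d y"
    "x \<in> Lambda k n \<Longrightarrow> d (c *\<^sub>Q x) = c *\<^sub>Q d x"
    "x \<in> Lambda k m \<Longrightarrow> y \<in> Lambda k n \<Longrightarrow> d (x * y) = d x * y + (- 1) ^ m * x * d y"
  using assms unfolding sullivan_algebra_def by blast+

lemma sullivan_algebra_zero:
  assumes "sullivan_algebra k d" shows "d 0 = 0"
  using sullivan_algebraD(6)[OF assms free_cga_deg_linear(1), of 0] by simp

lemma sullivan_algebra_one:
  assumes "sullivan_algebra k d" shows "d 1 = 0"
  using sullivan_algebraD(7)[OF assms one_in_free_cga_deg one_in_free_cga_deg] by simp

lemma sullivan_algebra_diff:
  assumes "sullivan_algebra k d" "x \<in> Lambda k n" "y \<in> Lambda k n"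
  shows "d (x - y) = d x - d y"
  using sullivan_algebraD(5)[OF assms(1) free_cga_deg_linear(3)[OF assms(2,3)] assms(3)]
  by (simp add: algebra_simps)

lemma coboundary_in: "y \<in> A n \<Longrightarrow> d y \<in> coboundaries A d (Suc n)"
  by (auto simp: coboundaries_def)

lemma sullivan_coboundariesE:
  assumes "sullivan_algebra k d" "x \<in> coboundaries (Lambda k) d (Suc n)"
  obtains y where "y \<in> Lambda k n" "x = d y"
  using assms sullivan_algebra_zero[OF assms(1)] free_cga_deg_linear(1)
  by (fastforce simp: coboundaries_def)

lemma sullivan_coboundaries_subspace:
  assumes "sullivan_algebra k d"
  shows "rat_vector.subspace (coboundaries (Lambda k) d n)"
proof (cases n)
  case (Suc i)
  then have "coboundaries (Lambda k) d n = d ` Lambda k i"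
    using sullivan_algebra_zero[OF assms] free_cga_deg_linear(1)
    by (force simp: coboundaries_def)
  then show ?thesis
    unfolding rat_vector.subspace_def
    using sullivan_algebraD(5,6)[OF assms] free_cga_deg_linear sullivan_algebra_zero[OF assms]
    by (auto simp: image_iff) (metis, metis+)
qed (auto simp: coboundaries_def rat_vector.subspace_def)

text \<open>
  This characterizes the formal dimension without presupposing that the cohomology is bounded, as is
  needed to transport it along the Gysin sequence and along quasi-isomorphisms.
\<close>

definition top_degree :: "(nat \<Rightarrow> 'a::rat_algebra_1 set) \<Rightarrow> ('a \<Rightarrow> 'a) \<Rightarrow> nat \<Rightarrow> bool" where
  "top_degree A d N \<longleftrightarrow> cohomology_nonzero A d N \<and> (\<forall>n>N. \<not> cohomology_nonzero A d n)"

lemma top_degree_unique: "top_degree A d M \<Longrightarrow> top_degree A d N \<Longrightarrow> M = N"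
  unfolding top_degree_def by (metis linorder_neqE_nat)

lemma formal_dimension_top_degree: "top_degree A d N \<Longrightarrow> formal_dimension A d = N"
  unfolding formal_dimension_def top_degree_def
  by (rule Greatest_equality) (auto intro: leI)

lemma sullivan_cohomology_nonzero_0:
  assumes "sullivan_algebra k d" shows "cohomology_nonzero (Lambda k) d 0"
proof -
  have "1 \<in> cocycles (Lambda k) d 0"
    by (simp add: cocycles_def one_in_free_cga_deg sullivan_algebra_one[OF assms])
  moreover have "1 \<notin> coboundaries (Lambda k) d 0"
    by (auto simp: coboundaries_def)
  ultimately show ?thesis
    by (auto simp: cohomology_nonzero_def)
qed

text \<open>
  In a degree beyond all monomials of a finite spanning set, the component of a combination
  of spanning cocycles and coboundaries is a coboundary.
\<close>

lemma finite_dim_cohomology_bounded: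
  assumes "sullivan_algebra k d" "finite_dim_cohomology (Lambda k) d"
  shows "\<exists>N. \<forall>n>N. \<not> cohomology_nonzero (Lambda k) d n"
proof -
  let ?Z = "cocycles (Lambda k) d" and ?C = "coboundaries (Lambda k) d"
  obtain B where B: "finite B" "(\<Union>n. ?Z n) \<subseteq> rat_vector.span (B \<union> (\<Union>n. ?C n))"
    using assms(2) by (auto simp: finite_dim_cohomology_def)
  define N where "N = Max (insert 0 (monomial_degree ` (\<Union>b\<in>B. monomials b)))"
  have "?Z n \<subseteq> ?C n" if "n > N" for n
  proof
    fix x assume x: "x \<in> ?Z n"
    have sub: "rat_vector.subspace (?C n)"
      by (rule sullivan_coboundaries_subspace[OF assms(1)])
    have "monomial_degree m \<le> N" if "b \<in> B" "m \<in> monomials b" for b m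
      unfolding N_def using that B(1) by (intro Max_ge) auto
    then have comp_B: "component n b = 0" if "b \<in> B" for b
      using that \<open>n > N\<close> by (intro cga_eqI) (fastforce simp: in_monomials_iff)
    have comp_C: "component n y \<in> ?C n" if y: "y \<in> ?C i" for y i
    proof (cases "y = 0")
      case False
      with y obtain j z where z: "z \<in> Lambda k j" "i = Suc j" "y = d z"
        by (auto simp: coboundaries_def)
      then have "component n y = (if i = n then y else 0)"
        using sullivan_algebraD(3)[OF assms(1)] component_free_cga_deg by blast
      then show ?thesis
        using y by (auto simp: coboundaries_def)
    qed (auto simp: restrict_monomials_linear coboundaries_def)
    have "rat_vector.subspace {y. component n y \<in> ?C n}"
      using sub unfolding rat_vector.subspace_def by (auto simp: restrict_monomials_linear)
    moreover have "B \<union> (\<Union>n. ?C n) \<subseteq> {y. component n y \<in> ?C n}"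
      using comp_B comp_C rat_vector.subspace_0[OF sub] by auto
    ultimately have "rat_vector.span (B \<union> (\<Union>n. ?C n)) \<subseteq> {y. component n y \<in> ?C n}"
      by (intro rat_vector.span_minimal)
    moreover have "x \<in> rat_vector.span (B \<union> (\<Union>n. ?C n))"
      using B(2) x by blast
    ultimately have "component n x \<in> ?C n"
      by (meson mem_Collect_eq subsetD)
    then show "x \<in> ?C n"
      using x component_free_cga_deg[of x "gens k" n n] by (simp add: cocycles_def)
  qed
  then show ?thesis
    by (auto simp: cohomology_nonzero_def)
qed

text \<open>A top degree exists because the class of the unit keeps the cohomology from vanishing.\<close>

lemma finite_dim_cohomology_top_degree:
  assumes "sullivan_algebra k d" "finite_dim_cohomology (Lambda k) d"
  shows "\<exists>N. top_degree (Lambda k) d N"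
proof -
  obtain N where N: "\<forall>n>N. \<not> cohomology_nonzero (Lambda k) d n"
    using finite_dim_cohomology_bounded[OF assms] by blast
  then have "\<exists>n. cohomology_nonzero (Lambda k) d n
      \<and> (\<forall>i. cohomology_nonzero (Lambda k) d i \<longrightarrow> i \<le> n)"
    using sullivan_cohomology_nonzero_0[OF assms(1)]
    by (intro ex_has_greatest_nat[where b = "Suc N"]) (auto simp: less_Suc_eq_le intro: leI)
  then show ?thesis
    unfolding top_degree_def by (metis not_le)
qed


section \<open>Extensions of Sullivan algebras by polynomial generators\<close>

lemma gens_adjoin: "gens (adjoin r k) = gens k \<union> poly_gen k ` {..<r}"
proof (rule Set.set_eqI)
  fix g
  obtain n i where g: "g = Gen n i"
    by (cases g)
  have "Gen 2 i \<in> poly_gen k ` {..<r}" if "i < k 2 + r" "\<not> i < k 2"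
    using that by (intro image_eqI[of _ _ "i - k 2"]) (auto simp: poly_gen_def)
  then show "g \<in> gens (adjoin r k) \<longleftrightarrow> g \<in> gens k \<union> poly_gen k ` {..<r}"
    by (auto simp: g gens_def adjoin_def poly_gen_def)
qed

lemma poly_gen_notin_gens: "poly_gen k j \<notin> gens k"
  by (simp add: gens_def poly_gen_def)

lemma poly_gen_in_gens: "j < r \<Longrightarrow> poly_gen k j \<in> gens (adjoin r k)"
  by (simp add: gens_adjoin)

lemma gdeg_poly_gen [simp]: "gdeg (poly_gen k j) = 2"
  by (simp add: poly_gen_def)

lemma adjoin_0: "adjoin 0 k = k"
  by (simp add: adjoin_def)

lemma adjoin_Suc: "adjoin (Suc r) k = adjoin 1 (adjoin r k)"
  by (simp add: adjoin_def)

lemma poly_gen_adjoin: "poly_gen (adjoin r k) 0 = poly_gen k r"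
  by (simp add: poly_gen_def adjoin_def)

text \<open>
  The differential \<open>D\<close> reduces to \<open>d\<close> modulo the new generators, expressed by saying that the map
  killing them commutes with the differentials. In contrast to a condition on generators, this is
  immediately stable under killing some of the new generators only.
\<close>

definition torus_extension ::
    "nat \<Rightarrow> (nat \<Rightarrow> nat) \<Rightarrow> (cga \<Rightarrow> cga) \<Rightarrow> (cga \<Rightarrow> cga) \<Rightarrow> bool" where
  "torus_extension r k d D \<longleftrightarrow>
    sullivan_algebra k d \<and> sullivan_algebra (adjoin r k) D \<and>
    (\<forall>j<r. D (gen_elt (poly_gen k j)) = 0) \<and>
    (\<forall>n. \<forall>x \<in> Lambda (adjoin r k) n. retract (gens k) (D x) = d (retract (gens k) x))"

text \<open>
  Both composites of the retraction with the differentials are derivations over it, so it suffices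
  to compare them on generators.
\<close>

lemma relative_model_torus_extension:
  assumes d: "sullivan_algebra k d" and rel: "relative_model r k d D"
  shows "torus_extension r k d D"
proof -
  let ?G = "gens k" and ?H = "gens (adjoin r k)"
  have D: "sullivan_algebra (adjoin r k) D"
    and t: "\<And>j. j < r \<Longrightarrow> D (gen_elt (poly_gen k j)) = 0"
    and ideal: "\<And>g. g \<in> ?G \<Longrightarrow> D (gen_elt g) - d (gen_elt g) \<in> poly_ideal r k"
    using rel by (auto simp: relative_model_def)
  have sub: "?G \<subseteq> ?H"
    by (simp add: gens_adjoin)
  have gen: "retract ?G (D (gen_elt g)) = d (retract ?G (gen_elt g))" if g: "g \<in> ?H" for g
  proof (cases "g \<in> ?G")
    case True
    have sum: "retract ?G (sum f A) = (\<Sum>a\<in>A. retract ?G (f a))" if "finite A" for f and A :: "nat set"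
      using that by (induction A) (auto simp: restrict_monomials_linear)
    obtain a where "D (gen_elt g) - d (gen_elt g) = (\<Sum>j<r. gen_elt (poly_gen k j) * a j)"
      using ideal[OF True] by (auto simp: poly_ideal_def)
    then have "retract ?G (D (gen_elt g) - d (gen_elt g)) = 0"
      by (simp add: sum retract_mult retract_gen_elt poly_gen_notin_gens)
    moreover have "retract ?G (d (gen_elt g)) = d (gen_elt g)"
      using sullivan_algebraD(3)[OF d gen_elt_in_free_cga_deg[OF True]] by (rule retract_id)
    ultimately show ?thesis
      using True by (simp add: retract_gen_elt restrict_monomials_linear)
  next
    case False
    with g obtain j where "j < r" "g = poly_gen k j"
      by (auto simp: gens_adjoin)
    with False show ?thesis
      by (simp add: t retract_gen_elt restrict_monomials_linear sullivan_algebra_zero[OF d])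
  qed
  have mono: "retract ?G (D (monomial m)) = d (retract ?G (monomial m))" if "set_mset m \<subseteq> ?H" for m
    using that
  proof (induction m)
    case empty
    then show ?case
      using sullivan_algebra_one[OF d] sullivan_algebra_one[OF D]
      by (simp add: retract_one restrict_monomials_linear flip: one_cga_def)
  next
    case (add g m)
    let ?x = "gen_elt g" and ?y = "monomial m"
    obtain c where c: "monomial (add_mset g m) = c *\<^sub>Q (?x * ?y)"
      using monomial_add_mset by blast
    have x: "?x \<in> Lambda (adjoin r k) (gdeg g)" and y: "?y \<in> Lambda (adjoin r k) (monomial_degree m)"
      using add.prems by (auto intro: gen_elt_in_free_cga_deg monomial_in_free_cga_deg)
    note rx = retract_in_free_cga_deg[OF x, of ?G] and ry = retract_in_free_cga_deg[OF y, of ?G]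
    have "retract ?G (D (?x * ?y)) = d (retract ?G (?x * ?y))"
      using add gen[of g]
      by (simp add: sullivan_algebraD(7)[OF D x y] sullivan_algebraD(7)[OF d rx ry]
          retract_mult retract_sign restrict_monomials_linear)
    then show ?case
      by (simp add: c sullivan_algebraD(6)[OF D free_cga_deg_mult[OF x y]] retract_mult
          sullivan_algebraD(6)[OF d free_cga_deg_mult[OF rx ry]] restrict_monomials_linear)
  qed
  have "retract ?G (D x) = d (retract ?G x)" if "x \<in> Lambda (adjoin r k) n" for n x
    using that
  proof (induction x rule: free_cga_deg_induct)
    case zero
    show ?case
      by (simp add: restrict_monomials_linear sullivan_algebra_zero[OF d] sullivan_algebra_zero[OF D])
  next
    case (add x y)
    then show ?case
      using sullivan_algebraD(5)[OF D add(1,2)]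
        sullivan_algebraD(5)[OF d retract_in_free_cga_deg[OF add(1)] retract_in_free_cga_deg[OF add(2)]]
      by (simp add: restrict_monomials_linear)
  next
    case (scale c x)
    then show ?case
      using sullivan_algebraD(6)[OF D scale(1)]
        sullivan_algebraD(6)[OF d retract_in_free_cga_deg[OF scale(1)]]
      by (simp add: restrict_monomials_linear)
  qed (rule mono)
  with d D t show ?thesis
    by (simp add: torus_extension_def)
qed

lemma torus_extension_0:
  assumes "torus_extension 0 k d D" "x \<in> Lambda k n"
  shows "D x = d x"
  using assms sullivan_algebraD(3)[of k D] unfolding torus_extension_def adjoin_0
  by (metis retract_id)

lemma poly_gen_mult_differential:
  assumes "sullivan_algebra (adjoin r k) D" "D (gen_elt (poly_gen k j)) = 0" "j < r"
    and "y \<in> Lambda (adjoin r k) n"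
  shows "D (gen_elt (poly_gen k j) * y) = gen_elt (poly_gen k j) * D y"
  using sullivan_algebraD(7)[OF assms(1) gen_elt_in_free_cga_deg[OF poly_gen_in_gens[OF assms(3)]] assms(4)]
    assms(2) by simp

text \<open>Killing the last polynomial generator splits an extension into a tower.\<close>

lemma torus_extension_Suc:
  assumes ext: "torus_extension (Suc r) k d D"
  defines "E \<equiv> \<lambda>x. retract (gens (adjoin r k)) (D x)"
  shows "torus_extension r k d E" "torus_extension 1 (adjoin r k) E D"
proof -
  let ?G = "gens (adjoin r k)" and ?t = "poly_gen k r"
  have d: "sullivan_algebra k d" and D: "sullivan_algebra (adjoin (Suc r) k) D"
    and t: "\<And>j. j \<le> r \<Longrightarrow> D (gen_elt (poly_gen k j)) = 0"
    and chain: "\<And>n x. x \<in> Lambda (adjoin (Suc r) k) n \<Longrightarrow>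
      retract (gens k) (D x) = d (retract (gens k) x)"
    using ext by (auto simp: torus_extension_def)
  have H: "gens (adjoin (Suc r) k) = insert ?t ?G"
    by (auto simp: gens_adjoin lessThan_Suc)
  have notin: "?t \<notin> ?G"
    by (auto simp: gens_def adjoin_def poly_gen_def)
  have up: "x \<in> Lambda (adjoin (Suc r) k) n" if "x \<in> Lambda (adjoin r k) n" for x n
    using that H by (auto intro: free_cga_deg_mono)
  have proj: "retract ?G (D x) = retract ?G (D (retract ?G x))"
    if x: "x \<in> Lambda (adjoin (Suc r) k) n" for x n
  proof -
    have rx: "retract ?G x \<in> Lambda (adjoin (Suc r) k) n"
      using x by (intro up retract_in_free_cga_deg)
    have "x - retract ?G x \<in> free_cga_deg (insert ?t ?G) n"
      "retract ?G (x - retract ?G x) = 0"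
      using free_cga_deg_linear(3)[OF x rx] by (simp_all add: H restrict_monomials_linear retract_retract)
    from divisible_by_even_generator[OF _ notin this]
    have "retract ?G (D (x - retract ?G x)) = 0"
    proof
      assume "\<exists>i y. n = gdeg ?t + i \<and> y \<in> free_cga_deg (insert ?t ?G) i
        \<and> x - retract ?G x = gen_elt ?t * y"
      then obtain i y where "y \<in> Lambda (adjoin (Suc r) k) i" "x - retract ?G x = gen_elt ?t * y"
        using H by auto
      then show ?thesis
        using poly_gen_mult_differential[OF D t, of r] notin
        by (simp add: retract_mult retract_gen_elt)
    qed (simp_all add: sullivan_algebra_zero[OF D] restrict_monomials_linear)
    then show ?thesis
      using sullivan_algebra_diff[OF D x rx] by (simp add: restrict_monomials_linear)
  qed
  have E: "sullivan_algebra (adjoin r k) E"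
    unfolding sullivan_algebra_def
  proof (intro conjI allI ballI)
    show "adjoin r k 0 = 0" "adjoin r k 1 = 0"
      using sullivan_algebraD(1,2)[OF d] by (simp_all add: adjoin_def)
  next
    fix n x assume x: "x \<in> Lambda (adjoin r k) n"
    show "E x \<in> Lambda (adjoin r k) (Suc n)"
      unfolding E_def using sullivan_algebraD(3)[OF D up[OF x]] by (rule retract_in_free_cga_deg)
    show "E (E x) = 0"
      unfolding E_def
      using proj[OF sullivan_algebraD(3)[OF D up[OF x]]] sullivan_algebraD(4)[OF D up[OF x]]
      by (simp add: restrict_monomials_linear)
    show "E (c *\<^sub>Q x) = c *\<^sub>Q E x" for c
      unfolding E_def by (simp add: sullivan_algebraD(6)[OF D up[OF x]] restrict_monomials_linear)
    fix y assume y: "y \<in> Lambda (adjoin r k) n"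
    show "E (x + y) = E x + E y"
      unfolding E_def
      by (simp add: sullivan_algebraD(5)[OF D up[OF x] up[OF y]] restrict_monomials_linear)
  next
    fix m n x y assume x: "x \<in> Lambda (adjoin r k) m" and y: "y \<in> Lambda (adjoin r k) n"
    show "E (x * y) = E x * y + (- 1) ^ m * x * E y"
      unfolding E_def
      by (simp add: sullivan_algebraD(7)[OF D up[OF x] up[OF y]] restrict_monomials_linear
          retract_mult retract_sign retract_id[OF x] retract_id[OF y])
  qed
  have "gens k \<subseteq> ?G"
    by (simp add: gens_adjoin)
  then have "retract (gens k) (E x) = d (retract (gens k) x)" if "x \<in> Lambda (adjoin r k) n" for x n
    using chain[OF up[OF that]] by (simp add: E_def retract_retract)
  moreover have "E (gen_elt (poly_gen k j)) = 0" if "j < r" for j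
    using t[of j] that by (simp add: E_def restrict_monomials_linear)
  ultimately show "torus_extension r k d E"
    using d E unfolding torus_extension_def by blast
  show "torus_extension 1 (adjoin r k) E D"
    unfolding torus_extension_def adjoin_Suc[symmetric]
    using E D t proj by (auto simp: poly_gen_adjoin E_def)
qed


section \<open>The Gysin sequence\<close>

text \<open>
  The relevant parts of the Gysin sequence, by diagram chases with cochains. A nonzero class of degree
  \<open>N\<close> is killed by multiplication with \<open>\<tau>\<close>, since \<open>N + 2\<close> exceeds the top degree, and so comes from a
  class of degree \<open>N + 1\<close> of the fibre. Above degree \<open>N + 1\<close>, the groups on both sides of the one
  of the fibre vanish.
\<close>

lemma torus_extension_top_degree_1:
  assumes ext: "torus_extension 1 k d D" and top: "top_degree (Lambda (adjoin 1 k)) D N"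
  shows "top_degree (Lambda k) d (Suc N)"
proof -
  let ?G = "gens k" and ?A = "Lambda k" and ?B = "Lambda (adjoin 1 k)" and ?t = "poly_gen k 0"
  let ?\<tau> = "gen_elt ?t"
  have d: "sullivan_algebra k d" and D: "sullivan_algebra (adjoin 1 k) D"
    and t: "D ?\<tau> = 0"
    and chain: "\<And>n x. x \<in> ?B n \<Longrightarrow> retract ?G (D x) = d (retract ?G x)"
    using ext by (auto simp: torus_extension_def)
  have H: "gens (adjoin 1 k) = insert ?t ?G"
    by (auto simp: gens_adjoin)
  have \<tau>: "?\<tau> \<in> ?B 2"
    using gen_elt_in_free_cga_deg[OF poly_gen_in_gens[of 0 1 k]] by simp
  have up: "x \<in> ?B n" if "x \<in> ?A n" for x n
    using that H by (auto intro: free_cga_deg_mono)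
  have r\<tau>: "retract ?G (?\<tau> * y) = 0" for y
    by (simp add: retract_mult retract_gen_elt poly_gen_notin_gens)
  have D\<tau>: "D (?\<tau> * y) = ?\<tau> * D y" if "y \<in> ?B n" for y n
    using poly_gen_mult_differential[OF D t _ that] by simp
  have cancel: "x = y" if "?\<tau> * x = ?\<tau> * y" for x y
    using gen_elt_even_mult_cancel[OF _ that] by simp
  \<comment> \<open>In degrees below two, where the subtraction truncates, the quotient is zero.\<close>
  have divide: "\<exists>y. y \<in> ?B (n - 2) \<and> x = ?\<tau> * y \<and> (n < 2 \<longrightarrow> y = 0)"
    if "x \<in> ?B n" "retract ?G x = 0" for x n
    using divisible_by_even_generator[of ?t ?G x n] that H poly_gen_notin_gens[of k 0]
    by (auto intro: free_cga_deg_linear exI[of _ 0])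
  have exact: "\<exists>y. y \<in> ?B (n - 1) \<and> x = D y" if "n > N" "x \<in> ?B n" "D x = 0" for x n
  proof -
    have "x \<in> coboundaries ?B D (Suc (n - 1))"
      using top that by (auto simp: top_degree_def cohomology_nonzero_def cocycles_def)
    then show ?thesis
      using sullivan_coboundariesE[OF D] by metis
  qed
  have "cohomology_nonzero ?A d (Suc N)"
    unfolding cohomology_nonzero_def
  proof
    assume zero: "cocycles ?A d (Suc N) \<subseteq> coboundaries ?A d (Suc N)"
    \<comment> \<open>The restriction of \<open>w\<close> with \<open>D w = \<tau> z\<close> is the preimage of the class of \<open>z\<close> under the
      connecting map; if it were \<open>d b\<close>, then division of \<open>w - D b\<close> by \<open>\<tau>\<close> would make \<open>z\<close> a coboundary.\<close>
    obtain z where z: "z \<in> ?B N" "D z = 0" "z \<notin> coboundaries ?B D N"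
      using top by (auto simp: top_degree_def cohomology_nonzero_def cocycles_def)
    have "?\<tau> * z \<in> ?B (N + 2)" "D (?\<tau> * z) = 0"
      using free_cga_deg_mult[OF \<tau> z(1)] D\<tau>[OF z(1)] z(2) by (simp_all add: add.commute)
    then obtain w where w: "w \<in> ?B (Suc N)" "?\<tau> * z = D w"
      using exact[of "N + 2"] by fastforce
    have "retract ?G w \<in> cocycles ?A d (Suc N)"
      using chain[OF w(1)] r\<tau>[of z] w
      by (simp add: cocycles_def retract_in_free_cga_deg)
    then obtain b where b: "b \<in> ?A N" "retract ?G w = d b"
      using zero sullivan_coboundariesE[OF d] by blast
    have "retract ?G (w - D b) = 0" "w - D b \<in> ?B (Suc N)"
      using chain[OF up[OF b(1)]] b sullivan_algebraD(3)[OF D up[OF b(1)]] w(1)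
      by (simp_all add: restrict_monomials_linear retract_id free_cga_deg_linear)
    then obtain y where y: "y \<in> ?B (Suc N - 2)" "w - D b = ?\<tau> * y" "Suc N < 2 \<longrightarrow> y = 0"
      using divide by blast
    have "?\<tau> * z = D (w - D b)"
      using sullivan_algebra_diff[OF D w(1) sullivan_algebraD(3)[OF D up[OF b(1)]]]
        sullivan_algebraD(4)[OF D up[OF b(1)]] w(2) by simp
    then have "z = D y"
      using y D\<tau> cancel by simp
    then have "z \<in> coboundaries ?B D N"
      using y sullivan_algebra_zero[OF D] by (cases N) (auto simp: coboundaries_def)
    with z(3) show False ..
  qed
  moreover have "\<not> cohomology_nonzero ?A d n" if n: "n > Suc N" for n
    unfolding cohomology_nonzero_def not_not
  proof
    fix a assume "a \<in> cocycles ?A d n"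
    then have a: "a \<in> ?A n" "d a = 0"
      by (simp_all add: cocycles_def)
    \<comment> \<open>The class of \<open>y\<close> with \<open>D a = \<tau> y\<close> is the obstruction to extending the cocycle \<open>a\<close>; as
      \<open>y = D u\<close>, the element \<open>a - \<tau> u\<close> is a cocycle that restricts to \<open>a\<close>.\<close>
    have "retract ?G (D a) = 0"
      using chain[OF up[OF a(1)]] a retract_id[OF a(1)] by simp
    then obtain y where y: "y \<in> ?B (n - 1)" "D a = ?\<tau> * y"
      using divide[OF sullivan_algebraD(3)[OF D up[OF a(1)]]] by force
    have "?\<tau> * D y = ?\<tau> * 0"
      using D\<tau>[OF y(1)] y(2) sullivan_algebraD(4)[OF D up[OF a(1)]] by simp
    then have "D y = 0"
      by (rule cancel)
    moreover have "N < n - 1" "n - 1 - 1 = n - 2"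
      using n by simp_all
    ultimately obtain u where u: "u \<in> ?B (n - 2)" "y = D u"
      using exact[of "n - 1" y] y(1) by metis
    have "2 + (n - 2) = n"
      using n by simp
    then have \<tau>u: "?\<tau> * u \<in> ?B n"
      using free_cga_deg_mult[OF \<tau> u(1)] by metis
    have "a - ?\<tau> * u \<in> ?B n" "D (a - ?\<tau> * u) = 0"
      using free_cga_deg_linear(3)[OF up[OF a(1)] \<tau>u] sullivan_algebra_diff[OF D up[OF a(1)] \<tau>u]
        D\<tau>[OF u(1)] y(2) u(2) by simp_all
    then obtain v where v: "v \<in> ?B (n - 1)" "a - ?\<tau> * u = D v"
      using exact[of n "a - ?\<tau> * u"] n by (meson Suc_lessD)
    have "a = d (retract ?G v)"
      using arg_cong[OF v(2), of "retract ?G"] chain[OF v(1)] retract_id[OF a(1)] r\<tau>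
      by (simp add: restrict_monomials_linear)
    moreover have "d (retract ?G v) \<in> coboundaries ?A d (Suc (n - 1))"
      using v(1) by (intro coboundary_in retract_in_free_cga_deg)
    moreover have "Suc (n - 1) = n"
      using n by simp
    ultimately show "a \<in> coboundaries ?A d n"
      by metis
  qed
  ultimately show ?thesis
    by (simp add: top_degree_def)
qed

lemma torus_extension_top_degree:
  assumes "torus_extension r k d D" "top_degree (Lambda (adjoin r k)) D N"
  shows "top_degree (Lambda k) d (N + r)"
  using assms
proof (induction r arbitrary: D N)
  case 0
  have "cocycles (Lambda k) D n = cocycles (Lambda k) d n" for n
    using torus_extension_0[OF 0(1)] by (auto simp: cocycles_def)
  moreover have "coboundaries (Lambda k) D n = coboundaries (Lambda k) d n" for n
    using torus_extension_0[OF 0(1)] by (force simp: coboundaries_def)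
  ultimately show ?case
    using 0(2) by (simp add: adjoin_0 top_degree_def cohomology_nonzero_def)
next
  case (Suc r)
  note E = torus_extension_Suc[OF Suc.prems(1)]
  show ?case
    using Suc.IH[OF E(1) torus_extension_top_degree_1[OF E(2), folded adjoin_Suc, OF Suc.prems(2)]]
    by simp
qed


section \<open>The toral rank is bounded by the formal dimension\<close>

lemma form_pullback_add: "form_pullback p \<theta> (x + y) = form_pullback p \<theta> x + form_pullback p \<theta> y"
  unfolding form_pullback_def algebra_extension_def by (rule linear_extension_add)

lemma A_PL_add:
  assumes "x \<in> A_PL X n" "y \<in> A_PL X n" shows "x + y \<in> A_PL X n"
proof -
  have "(x + y) p \<sigma> \<in> simplex_forms p n" if "singular_simplex p X \<sigma>" for p \<sigma>
  proof -
    have "x p \<sigma> \<in> simplex_forms p n" "y p \<sigma> \<in> simplex_forms p n"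
      using assms that unfolding A_PL_def by fastforce+
    then show ?thesis
      by (simp add: simplex_forms_def free_cga_deg_linear)
  qed
  moreover have "(x + y) p \<sigma> = 0" if "\<not> singular_simplex p X \<sigma>" for p \<sigma>
  proof -
    have "x p \<sigma> = 0" "y p \<sigma> = 0"
      using assms that unfolding A_PL_def by fastforce+
    then show ?thesis
      by simp
  qed
  moreover have "(x + y) p (simplex_pullback p \<theta> \<sigma>) = form_pullback p \<theta> ((x + y) q \<sigma>)"
    if "mono_on {..p} \<theta>" "\<theta> ` {..p} \<subseteq> {..q}" "singular_simplex q X \<sigma>" for p q \<theta> \<sigma>
  proof -
    have "x p (simplex_pullback p \<theta> \<sigma>) = form_pullback p \<theta> (x q \<sigma>)"
      "y p (simplex_pullback p \<theta> \<sigma>) = form_pullback p \<theta> (y q \<sigma>)"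
      using assms that unfolding A_PL_def by blast+
    then show ?thesis
      by (simp add: form_pullback_add)
  qed
  ultimately show ?thesis
    unfolding A_PL_def by simp
qed

lemma d_PL_add: "d_PL (x + y) = d_PL x + d_PL y"
  by (auto simp: d_PL_def de_rham_def derivation_extension_def linear_extension_add fun_eq_iff)

lemma coboundaries_A_PL_add:
  assumes "x \<in> coboundaries (A_PL X) d_PL n" "y \<in> coboundaries (A_PL X) d_PL n"
  shows "x + y \<in> coboundaries (A_PL X) d_PL n"
proof (cases "x = 0 \<or> y = 0")
  case False
  with assms obtain m u v where "n = Suc m" "u \<in> A_PL X m" "v \<in> A_PL X m" "x = d_PL u" "y = d_PL v"
    by (auto simp: coboundaries_def)
  then show ?thesis
    using coboundary_in[of "u + v" "A_PL X" m d_PL] by (simp add: d_PL_add A_PL_add)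
qed (use assms in auto)

text \<open>
  The toral rank of \<open>X\<close> ranges over all minimal models of \<open>X\<close>. Comparing each of them with the
  polynomial forms on \<open>X\<close> gives them the same top degree, and hence a common bound.
\<close>

lemma minimal_model_cohomology_nonzero:
  assumes "minimal_model_of X k d"
  shows "cohomology_nonzero (Lambda k) d n \<longleftrightarrow> cohomology_nonzero (A_PL X) d_PL n"
proof -
  obtain \<phi> where q: "quasi_isomorphism (Lambda k) d (A_PL X) d_PL \<phi>"
    using assms by (auto simp: minimal_model_of_def)
  have map: "\<phi> x \<in> A_PL X i" "\<phi> (d x) = d_PL (\<phi> x)" if "x \<in> Lambda k i" for x i
    using q that by (auto simp: quasi_isomorphism_def)
  have "\<phi> (0 *\<^sub>Q 0) = 0 *\<^sub>Q \<phi> 0"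
    using q free_cga_deg_linear(1)[of "gens k" n] unfolding quasi_isomorphism_def by blast
  then have zero: "\<phi> 0 = 0"
    by simp
  have "d 0 = 0"
    using assms sullivan_algebra_zero
    by (auto simp: minimal_model_of_def minimal_sullivan_algebra_def)
  have cob: "\<phi> x \<in> coboundaries (A_PL X) d_PL n" if "x \<in> coboundaries (Lambda k) d n" for x
    using that map zero by (fastforce simp: coboundaries_def)
  have coc: "\<phi> x \<in> cocycles (A_PL X) d_PL n" if "x \<in> cocycles (Lambda k) d n" for x
    using that map zero by (auto simp: cocycles_def) (metis)
  have inj: "x \<in> coboundaries (Lambda k) d n"
    if "x \<in> cocycles (Lambda k) d n" "\<phi> x \<in> coboundaries (A_PL X) d_PL n" for x
    using q that unfolding quasi_isomorphism_def by blast
  have surj: "\<exists>x \<in> cocycles (Lambda k) d n. z - \<phi> x \<in> coboundaries (A_PL X) d_PL n"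
    if "z \<in> cocycles (A_PL X) d_PL n" for z
    using q that unfolding quasi_isomorphism_def by blast
  have "cocycles (A_PL X) d_PL n \<subseteq> coboundaries (A_PL X) d_PL n"
    if sub: "cocycles (Lambda k) d n \<subseteq> coboundaries (Lambda k) d n"
  proof
    fix z assume "z \<in> cocycles (A_PL X) d_PL n"
    then obtain x where "x \<in> cocycles (Lambda k) d n" "z - \<phi> x \<in> coboundaries (A_PL X) d_PL n"
      using surj by blast
    with sub cob coboundaries_A_PL_add[of "z - \<phi> x" X n "\<phi> x"]
    show "z \<in> coboundaries (A_PL X) d_PL n"
      by auto
  qed
  then show ?thesis
    using coc inj unfolding cohomology_nonzero_def by blast
qed

lemma minimal_model_top_degree:
  "minimal_model_of X k d \<Longrightarrow> top_degree (Lambda k) d N \<longleftrightarrow> top_degree (A_PL X) d_PL N"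
  by (simp add: top_degree_def minimal_model_cohomology_nonzero)

lemma borel_model_torus_extension:
  assumes "sullivan_algebra k d" "borel_model r k d D"
  obtains N where "torus_extension r k d D" "top_degree (Lambda (adjoin r k)) D N"
    "top_degree (Lambda k) d (N + r)"
proof -
  have ext: "torus_extension r k d D"
    using assms by (simp add: borel_model_def relative_model_torus_extension)
  have "\<exists>N. top_degree (Lambda (adjoin r k)) D N"
    using assms by (intro finite_dim_cohomology_top_degree) (auto simp: borel_model_def relative_model_def)
  with ext torus_extension_top_degree that show thesis
    by blast
qed

lemma minimal_model_sullivan: "minimal_model_of X k d \<Longrightarrow> sullivan_algebra k d"
  by (simp add: minimal_model_of_def minimal_sullivan_algebra_def)

text \<open>
  The ranks of tori are bounded by the top degree of the cohomology of \<open>X\<close>. Without a bound the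
  greatest rank would be unspecified.
\<close>

lemma toral_rank_ge:
  assumes "minimal_model_of X k d" "borel_model r k d D"
  shows "r \<le> toral_rank X"
proof -
  let ?P = "\<lambda>r. \<exists>k d D. minimal_model_of X k d \<and> borel_model r k d D"
  have top: "\<exists>N. top_degree (A_PL X) d_PL (N + i)" if "?P i" for i
    using that minimal_model_top_degree minimal_model_sullivan borel_model_torus_extension by metis
  have P: "?P r"
    using assms by blast
  obtain M where M: "top_degree (A_PL X) d_PL M"
    using top[OF P] by blast
  have "i \<le> M" if "?P i" for i
    using top[OF that] top_degree_unique[OF M] by fastforce
  with P show ?thesis
    unfolding toral_rank_def by (intro Greatest_le_nat[where b = M]) auto
qed


section \<open>C-symplectic algebras have toral rank zero\<close>

lemma monomial_degree_ge:
  assumes "sullivan_algebra k d" "set_mset m \<subseteq> gens k"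
  shows "2 * size m \<le> monomial_degree m"
  using assms(2)
proof (induction m)
  case (add g m)
  then obtain n i where "g = Gen n i" "i < k n"
    by (auto simp: gens_def)
  then have "2 \<le> gdeg g"
    using sullivan_algebraD(1,2)[OF assms(1)] by (cases n; cases "n - 1") auto
  with add show ?case
    by (auto simp: monomial_degree_def)
qed (simp add: monomial_degree_def)

text \<open>A monomial of degree three is a single generator, so no polynomial generator occurs in it.\<close>

lemma Lambda_adjoin_3:
  assumes "sullivan_algebra (adjoin r k) D" "x \<in> Lambda (adjoin r k) 3"
  shows "x \<in> Lambda k 3"
  unfolding free_cga_deg_iff
proof (intro allI impI)
  fix m assume "coefficient x m \<noteq> 0"
  then have m: "set_mset m \<subseteq> gens (adjoin r k)" "monomial_degree m = 3"
    using assms(2) by (auto simp: free_cga_deg_iff)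
  have "size m \<noteq> 0"
    using m(2) by (auto simp: monomial_degree_def)
  then have "size m = 1"
    using monomial_degree_ge[OF assms(1) m(1)] m(2) by linarith
  then obtain g where g: "m = {#g#}"
    by (metis size_1_singleton_mset)
  then have "g \<notin> poly_gen k ` {..<r}"
    using m(2) by (auto simp: monomial_degree_def poly_gen_def)
  with g m show "set_mset m \<subseteq> gens k \<and> monomial_degree m = 3"
    by (auto simp: gens_adjoin)
qed

lemma sullivan_power_cocycle:
  assumes "sullivan_algebra k d" "x \<in> Lambda k 2" "d x = 0"
  shows "d (x ^ i) = 0"
  using assms
  by (induction i) (simp_all add: sullivan_algebra_one sullivan_algebraD(7)[OF _ _ free_cga_deg_power])

text \<open>
  For degree reasons the symplectic cocycle extends to the Borel model, where its top power is a
  coboundary because the top degree there is smaller by \<open>r\<close>.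
\<close>

lemma c_symplectic_borel_model:
  assumes d: "sullivan_algebra k d" and symp: "c_symplectic (Lambda k) d"
    and borel: "borel_model r k d D"
  shows "r = 0"
proof (rule ccontr)
  assume "r \<noteq> 0"
  obtain N where ext: "torus_extension r k d D" and top: "top_degree (Lambda (adjoin r k)) D N"
    "top_degree (Lambda k) d (N + r)"
    using borel_model_torus_extension[OF d borel] by blast
  have D: "sullivan_algebra (adjoin r k) D"
    and chain: "\<And>n x. x \<in> Lambda (adjoin r k) n \<Longrightarrow> retract (gens k) (D x) = d (retract (gens k) x)"
    using ext by (auto simp: torus_extension_def)
  obtain m \<omega> where m: "N + r = 2 * m" and \<omega>: "\<omega> \<in> Lambda k 2" "d \<omega> = 0"
    and nz: "\<omega> ^ m \<notin> coboundaries (Lambda k) d (2 * m)"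
    using symp formal_dimension_top_degree[OF top(2)] by (auto simp: c_symplectic_def cocycles_def)
  have \<omega>': "\<omega> \<in> Lambda (adjoin r k) 2"
    using \<omega>(1) by (rule free_cga_deg_mono[rotated]) (simp add: gens_adjoin)
  have "D \<omega> \<in> Lambda k 3"
    using Lambda_adjoin_3[OF D] sullivan_algebraD(3)[OF D \<omega>'] by (simp add: eval_nat_numeral)
  then have "D \<omega> = 0"
    using chain[OF \<omega>'] retract_id[of "D \<omega>"] retract_id[OF \<omega>(1)] \<omega>(2) by simp
  then have "\<omega> ^ m \<in> cocycles (Lambda (adjoin r k)) D (2 * m)"
    using sullivan_power_cocycle[OF D \<omega>'] free_cga_deg_power[OF \<omega>'] by (simp add: cocycles_def)
  moreover have "2 * m > N"
    using m \<open>r \<noteq> 0\<close> by simp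
  ultimately have "\<omega> ^ m \<in> coboundaries (Lambda (adjoin r k)) D (Suc (2 * m - 1))"
    using top(1) by (auto simp: top_degree_def cohomology_nonzero_def)
  then obtain y where y: "y \<in> Lambda (adjoin r k) (2 * m - 1)" "\<omega> ^ m = D y"
    using sullivan_coboundariesE[OF D] by metis
  have "\<omega> ^ m = d (retract (gens k) y)"
    using chain[OF y(1)] y(2) retract_id[OF free_cga_deg_power[OF \<omega>(1), of m]] by simp
  moreover have "retract (gens k) y \<in> Lambda k (2 * m - 1)"
    using y(1) by (rule retract_in_free_cga_deg)
  ultimately have "\<omega> ^ m \<in> coboundaries (Lambda k) d (Suc (2 * m - 1))"
    using coboundary_in by metis
  with nz \<open>2 * m > N\<close> show False
    by simp
qed

lemma c_symplectic_model_toral_rank: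
  assumes d: "sullivan_algebra k d" and symp: "c_symplectic (Lambda k) d"
  shows "model_toral_rank k d = 0"
proof -
  have "borel_model 0 k d d"
    using assms
    by (simp add: borel_model_def relative_model_def adjoin_0 poly_ideal_def c_symplectic_def
        poincare_duality_def)
  then show ?thesis
    unfolding model_toral_rank_def
    using c_symplectic_borel_model[OF assms] by (intro Greatest_equality) auto
qed

theorem theorem1p7:
  fixes X :: "'a topology"
  assumes "simply_connected_space X"
    and "pre_c_symplectic X"
  shows "(toral_rank X - 1, 1) \<in> hasse_points X"
proof -
  obtain k d D where min: "minimal_model_of X k d" and rel: "relative_model 1 k d D"
    and symp: "c_symplectic (Lambda (adjoin 1 k)) D"
    using assms(2) by (auto simp: pre_c_symplectic_def)
  have borel: "borel_model 1 k d D"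
    using rel symp by (simp add: borel_model_def c_symplectic_def poincare_duality_def)
  have "1 \<le> toral_rank X"
    using toral_rank_ge[OF min borel] .
  moreover have "model_toral_rank (adjoin 1 k) D = 0"
    using rel symp by (intro c_symplectic_model_toral_rank) (simp_all add: relative_model_def)
  ultimately show ?thesis
    using min borel by (auto simp: hasse_points_def)
qed

end
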